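(* Let $n=2$ and let $w(x):=(1+\log(1+|x|))(1+|x|)$ for $x\in\mathbf{R}^2$. Then there is no constant $C^*>0$ such that $$\left\|\frac{u}{w(\cdot)}\right\|_{L^2(\mathbf{R}^2)}\le C^*\|\nabla u\|_{L^2(\mathbf{R}^2)}\qquad\text{for all } u\in H^1(\mathbf{R}^2).$$
   Context: $H^1(\mathbf{R}^2)$ is the usual Sobolev space and $\log$ is the natural logarithm. *)

theory Defs
  imports "HOL-Analysis.Analysis"
begin

definition square_integrable :: "('a::euclidean_space \<Rightarrow> 'b::euclidean_space) \<Rightarrow> bool" where
  "square_integrable f \<longleftrightarrow>
     f \<in> borel_measurable lebesgue \<and> integrable lebesgue (\<lambda>x. (norm (f x))\<^sup>2)"

text \<open>As a Bochner integral, this is the \<open>L\<^sup>2\<close> norm only for square integrable \<open>f\<close>.\<close>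

definition L2_norm :: "('a::euclidean_space \<Rightarrow> 'b::euclidean_space) \<Rightarrow> real" where
  "L2_norm f = sqrt (integral\<^sup>L lebesgue (\<lambda>x. (norm (f x))\<^sup>2))"

definition locally_integrable :: "('a::euclidean_space \<Rightarrow> 'b::euclidean_space) \<Rightarrow> bool" where
  "locally_integrable f \<longleftrightarrow> (\<forall>K. compact K \<longrightarrow> set_integrable lebesgue K f)"

definition partial_deriv :: "'a::euclidean_space \<Rightarrow> ('a \<Rightarrow> real) \<Rightarrow> 'a \<Rightarrow> real" where
  "partial_deriv b f x = frechet_derivative f (at x) b"

primrec C_times :: "nat \<Rightarrow> ('a::euclidean_space \<Rightarrow> real) \<Rightarrow> bool" where
  "C_times 0 f \<longleftrightarrow> continuous_on UNIV f"
| "C_times (Suc k) f \<longleftrightarrow>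
     (\<forall>x. f differentiable (at x)) \<and> (\<forall>b\<in>Basis. C_times k (partial_deriv b f))"

definition test_function :: "('a::euclidean_space \<Rightarrow> real) \<Rightarrow> bool" where
  "test_function \<phi> \<longleftrightarrow> (\<forall>k. C_times k \<phi>) \<and> compact (closure {x. \<phi> x \<noteq> 0})"

text \<open>
  The weak gradient \<open>G\<close> of \<open>u\<close> is determined only up to a null set, so it is rendered as a
  relation, in the style of \<^const>\<open>has_derivative\<close>.
\<close>

definition has_weak_gradient ::
    "('a::euclidean_space \<Rightarrow> real) \<Rightarrow> ('a \<Rightarrow> 'a) \<Rightarrow> bool" where
  "has_weak_gradient u G \<longleftrightarrow>
     locally_integrable u \<and> locally_integrable G \<and>
     (\<forall>\<phi>. test_function \<phi> \<longrightarrow> (\<forall>b\<in>Basis.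
        integral\<^sup>L lebesgue (\<lambda>x. u x * partial_deriv b \<phi> x) =
        - integral\<^sup>L lebesgue (\<lambda>x. (G x \<bullet> b) * \<phi> x)))"

text \<open>The elements are functions, not classes modulo equality almost everywhere.\<close>

definition sobolev_H1 :: "('a::euclidean_space \<Rightarrow> real) set" where
  "sobolev_H1 =
     {u. square_integrable u \<and> (\<exists>G. has_weak_gradient u G \<and> square_integrable G)}"

definition w :: "real ^ 2 \<Rightarrow> real" where
  "w x = (1 + ln (1 + norm x)) * (1 + norm x)"

end

(* The functions u_n = (max 0 (1 - ln (1 + |x|^2) / n))^2 are C^1 with compact support and
   |grad u_n|^2 <= 16 / (n^2 (1 + |x|^2)) on their support, which is contained in
   {1 + |x|^2 <= e^n}.  In the plane the integral of 1 / (1 + |x|^2) over this set is only O(n),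
   so the Dirichlet energy of u_n is O(1/n), while u_n / w stays bounded below on the unit disc. *)

theory Submission
  imports Defs
begin

section \<open>Lebesgue integrals of continuous functions with bounded support\<close>

lemma integrable_lebesgue_continuous_on_compact:
  fixes f :: "'a::euclidean_space \<Rightarrow> 'b::euclidean_space"
  assumes "continuous_on S f" "compact S"
  shows "set_integrable lebesgue S f"
proof -
  have "integrable lborel (\<lambda>x. indicator S x *\<^sub>R f x)"
    using borel_integrable_compact[OF assms(2,1)]
    by (simp add: indicator_scaleR_eq_if)
  then show ?thesis
    unfolding set_integrable_def
    by (subst integrable_completion) (auto dest: borel_measurable_integrable)
qed

lemma integrable_lebesgue_compact_support:
  fixes f :: "'a::euclidean_space \<Rightarrow> 'b::euclidean_space"
  assumes "continuous_on UNIV f" and "\<And>x. norm x > R \<Longrightarrow> f x = 0"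
  shows "integrable lebesgue f"
proof -
  have "set_integrable lebesgue (cball 0 R) f"
    using assms(1) continuous_on_subset
    by (intro integrable_lebesgue_continuous_on_compact) auto
  moreover have "(\<lambda>x. indicator (cball 0 R) x *\<^sub>R f x) = f"
    using assms(2) by (force simp: indicator_def)
  ultimately show ?thesis
    by (simp add: set_integrable_def)
qed

lemma borel_measurable_lebesgue_continuous:
  fixes f :: "'a::euclidean_space \<Rightarrow> 'b::euclidean_space"
  assumes "continuous_on UNIV f"
  shows "f \<in> borel_measurable lebesgue"
  using borel_measurable_continuous_onI[OF assms] by (simp add: measurable_completion)

section \<open>Integration by parts and weak gradients of C^1 functions\<close>

lemma integral_lebesgue_shift:
  fixes f :: "'a::euclidean_space \<Rightarrow> real"
  assumes "continuous_on UNIV f"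
  shows "(\<integral>x. f (x + c) \<partial>lebesgue) = (\<integral>x. f x \<partial>lebesgue)"
proof -
  have f: "f \<in> borel_measurable borel"
    using assms by (rule borel_measurable_continuous_onI)
  have "(\<integral>x. f x \<partial>lborel) = (\<integral>x. f x \<partial>(distr lborel borel ((+) c)))"
    by (simp add: lborel_distr_plus)
  also have "\<dots> = (\<integral>x. f (c + x) \<partial>lborel)"
    using f by (subst integral_distr) auto
  finally show ?thesis
    using f by (simp add: integral_completion add.commute)
qed

text \<open>Translation invariance makes the difference quotients integrate to zero, and by the mean
  value theorem they are dominated by a constant on a fixed ball.\<close>

lemma integral_directional_derivative_eq_0:
  fixes f :: "'a::euclidean_space \<Rightarrow> real"
  assumes f: "\<And>x. (f has_derivative D x) (at x)"
    and D: "continuous_on UNIV (\<lambda>x. D x b)"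
    and supp: "\<And>x. norm x > R \<Longrightarrow> f x = 0"
  shows "(\<integral>x. D x b \<partial>lebesgue) = 0"
proof -
  define h where "h k = inverse (real (Suc k))" for k
  define q where "q k x = (f (x + h k *\<^sub>R b) - f x) / h k" for k x
  have h: "0 < h k" "h k \<le> 1" for k
    by (auto simp: h_def field_simps)
  have h0: "h \<longlonglongrightarrow> 0"
    unfolding h_def by (rule LIMSEQ_inverse_real_of_nat)
  have cf: "continuous_on UNIV f"
    by (meson f has_derivative_continuous continuous_at_imp_continuous_on)
  have cs: "continuous_on UNIV (\<lambda>x. f (x + c))" for c
    by (intro continuous_on_compose2[OF cf] continuous_intros) auto
  have line: "((\<lambda>t. f (x + t *\<^sub>R b)) has_real_derivative D (x + t *\<^sub>R b) b) (at t)" for x t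
  proof -
    have "((\<lambda>t. f (x + t *\<^sub>R b)) has_derivative (\<lambda>s. D (x + t *\<^sub>R b) (s *\<^sub>R b))) (at t)"
      by (rule has_derivative_compose[OF _ f]) (auto intro!: derivative_eq_intros)
    moreover have "D y (s *\<^sub>R b) = D y b * s" for y s
      using linear_cmul[OF has_derivative_linear[OF f]] by (simp add: mult.commute)
    ultimately show ?thesis
      by (simp add: has_field_derivative_def)
  qed
  \<comment> \<open>The quotient \<open>q k\<close> vanishes unless
    \<open>norm x \<le> R + norm b\<close>, since otherwise both \<open>x\<close> and its shift lie
    outside the ball of radius \<open>R\<close>. The mean value point is at most another
    \<open>norm b\<close> away, hence the radius \<open>R + 2 * norm b\<close>.\<close>
  have "compact ((\<lambda>x. D x b) ` cball 0 (R + 2 * norm b))"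
    using D continuous_on_subset by (intro compact_continuous_image) auto
  then obtain M where M: "\<And>x. norm x \<le> R + 2 * norm b \<Longrightarrow> \<bar>D x b\<bar> \<le> M"
    by (force dest!: compact_imp_bounded simp: bounded_iff)
  have step: "norm (x + t *\<^sub>R b) \<le> norm x + norm b \<and> norm x \<le> norm (x + t *\<^sub>R b) + norm b"
    if "0 \<le> t" "t \<le> 1" for x t
  proof -
    have "norm (t *\<^sub>R b) \<le> norm b"
      using that by (simp add: mult_left_le_one_le)
    then show ?thesis
      using norm_triangle_ineq[of x "t *\<^sub>R b"] norm_triangle_ineq4[of "x + t *\<^sub>R b" "t *\<^sub>R b"]
      by auto
  qed
  have bound: "\<bar>q k x\<bar> \<le> indicator (cball 0 (R + norm b)) x * M" for k x
  proof (cases "norm x \<le> R + norm b")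
    case True
    obtain z where z: "0 < z" "z < h k"
      "f (x + h k *\<^sub>R b) - f (x + 0 *\<^sub>R b) = (h k - 0) * D (x + z *\<^sub>R b) b"
      using MVT2[OF h(1)[of k], of "\<lambda>t. f (x + t *\<^sub>R b)" "\<lambda>t. D (x + t *\<^sub>R b) b"] line by blast
    then have "q k x = D (x + z *\<^sub>R b) b"
      using h(1)[of k] by (simp add: q_def)
    moreover have "norm (x + z *\<^sub>R b) \<le> R + 2 * norm b"
      using step[of z x] True z h(2)[of k] by linarith
    ultimately show ?thesis
      using M True by simp
  next
    case False
    then have "f x = 0" "f (x + h k *\<^sub>R b) = 0"
      using step[of "h k" x] h[of k] by (intro supp; smt (verit) norm_ge_zero)+
    then show ?thesis
      using False by (simp add: q_def)
  qed
  have dom: "integrable lebesgue (\<lambda>x::'a. indicator (cball 0 (R + norm b)) x * M)"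
    using integrable_lebesgue_continuous_on_compact[of "cball 0 (R + norm b)" "\<lambda>_::'a. M"]
    by (simp add: set_integrable_def)
  have lim: "(\<lambda>k. q k x) \<longlonglongrightarrow> D x b" for x
  proof -
    have "((\<lambda>t. (f (x + t *\<^sub>R b) - f x) / t) \<longlongrightarrow> D x b) (at 0)"
      using line[of x 0] by (simp add: DERIV_def)
    moreover have "filterlim h (at 0) sequentially"
      using h0 h(1) by (auto simp: filterlim_at intro!: eventuallyI less_imp_neq[symmetric])
    ultimately show ?thesis
      unfolding q_def by (rule filterlim_compose)
  qed
  have q0: "(\<integral>x. q k x \<partial>lebesgue) = 0" for k
  proof -
    have "integrable lebesgue f"
      by (rule integrable_lebesgue_compact_support[OF cf supp])
    moreover have "integrable lebesgue (\<lambda>x. f (x + h k *\<^sub>R b))"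
    proof (rule integrable_lebesgue_compact_support[OF cs])
      show "norm x > R + norm b \<Longrightarrow> f (x + h k *\<^sub>R b) = 0" for x
        using step[of "h k" x] h[of k] by (intro supp) linarith
    qed
    ultimately show ?thesis
      by (simp add: q_def integral_lebesgue_shift[OF cf])
  qed
  have "(\<lambda>k. \<integral>x. q k x \<partial>lebesgue) \<longlonglongrightarrow> (\<integral>x. D x b \<partial>lebesgue)"
  proof (rule integral_dominated_convergence[OF _ _ dom])
    show "q k \<in> borel_measurable lebesgue" for k
      unfolding q_def using h(1)[of k]
      by (intro borel_measurable_lebesgue_continuous continuous_intros cs cf)
        (auto intro: less_imp_neq[symmetric])
    show "(\<lambda>x. D x b) \<in> borel_measurable lebesgue"
      by (rule borel_measurable_lebesgue_continuous[OF D])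
  qed (use bound lim in auto)
  then show ?thesis
    by (simp add: q0 LIMSEQ_const_iff)
qed

text \<open>The product rule for \<open>u x * \<phi> x\<close> turns the claim into the vanishing of
  the integral of a directional derivative, since this product vanishes outside a ball.\<close>

lemma has_weak_gradient_of_C1_compact_support:
  fixes u :: "'a::euclidean_space \<Rightarrow> real"
  assumes u: "\<And>x. (u has_derivative (\<lambda>h. G x \<bullet> h)) (at x)"
    and G: "continuous_on UNIV G"
    and supp: "\<And>x. norm x > R \<Longrightarrow> u x = 0"
  shows "has_weak_gradient u G"
  unfolding has_weak_gradient_def
proof (intro conjI allI impI ballI)
  have cu: "continuous_on UNIV u"
    by (meson u has_derivative_continuous continuous_at_imp_continuous_on)
  show "locally_integrable u" "locally_integrable G"
    unfolding locally_integrable_def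
    using cu G continuous_on_subset by (blast intro: integrable_lebesgue_continuous_on_compact)+
  fix \<phi> :: "'a \<Rightarrow> real" and b :: 'a
  assume \<phi>: "test_function \<phi>" and b: "b \<in> Basis"
  have "C_times (Suc 0) \<phi>"
    using \<phi> unfolding test_function_def by blast
  then have d\<phi>: "(\<phi> has_derivative frechet_derivative \<phi> (at x)) (at x)"
    and cd: "continuous_on UNIV (partial_deriv b \<phi>)" for x
    using b by (auto simp: frechet_derivative_works)
  have c\<phi>: "continuous_on UNIV \<phi>"
    by (meson d\<phi> has_derivative_continuous continuous_at_imp_continuous_on)
  have "bounded {x. \<phi> x \<noteq> 0}"
    using \<phi> by (auto simp: test_function_def intro: bounded_subset[OF compact_imp_bounded closure_subset])
  then obtain B where B: "\<And>x. norm x > B \<Longrightarrow> \<phi> x = 0"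
    unfolding bounded_iff by (metis (mono_tags, lifting) mem_Collect_eq not_le)
  have "(\<integral>x. u x * partial_deriv b \<phi> x + (G x \<bullet> b) * \<phi> x \<partial>lebesgue) = 0"
    unfolding partial_deriv_def
  proof (rule integral_directional_derivative_eq_0
      [where f = "\<lambda>x. u x * \<phi> x" and R = R and b = b and
        D = "\<lambda>x h. u x * frechet_derivative \<phi> (at x) h + (G x \<bullet> h) * \<phi> x"])
    show "((\<lambda>x. u x * \<phi> x) has_derivative
        (\<lambda>h. u x * frechet_derivative \<phi> (at x) h + (G x \<bullet> h) * \<phi> x)) (at x)" for x
      by (rule has_derivative_mult[OF u d\<phi>])
  qed (auto intro!: continuous_intros cu cd[unfolded partial_deriv_def] c\<phi> G simp: supp)
  \<comment> \<open>Splitting the integral of the sum requires both terms to be integrable: the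
    support of \<open>u\<close> confines the first, that of \<open>\<phi>\<close> the
    second.\<close>
  moreover have "integrable lebesgue (\<lambda>x. u x * partial_deriv b \<phi> x)"
    by (rule integrable_lebesgue_compact_support[where R = R])
      (auto intro!: continuous_intros cu cd simp: supp)
  moreover have "integrable lebesgue (\<lambda>x. (G x \<bullet> b) * \<phi> x)"
    by (rule integrable_lebesgue_compact_support[where R = B])
      (auto intro!: continuous_intros G c\<phi> simp: B)
  ultimately show "(\<integral>x. u x * partial_deriv b \<phi> x \<partial>lebesgue) =
      - (\<integral>x. (G x \<bullet> b) * \<phi> x \<partial>lebesgue)"
    by simp
qed

lemma square_integrable_continuous_compact_support:
  fixes f :: "'a::euclidean_space \<Rightarrow> 'b::euclidean_space"
  assumes "continuous_on UNIV f" and "\<And>x. norm x > R \<Longrightarrow> f x = 0"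
  shows "square_integrable f"
  unfolding square_integrable_def
  using assms
  by (auto intro!: borel_measurable_lebesgue_continuous continuous_intros
      integrable_lebesgue_compact_support[where R = R])

section \<open>The logarithmic cutoffs and their gradients\<close>

text \<open>The argument \<open>1 + x \<bullet> x\<close> keeps the logarithm smooth at the origin.
  For \<open>n = 0\<close> division by zero yields the constant 1, so the support is bounded only
  for \<open>n > 0\<close>.\<close>

definition log_profile :: "nat \<Rightarrow> 'a::euclidean_space \<Rightarrow> real" where
  "log_profile n x = max 0 (1 - ln (1 + x \<bullet> x) / n)"

text \<open>Squaring makes the cutoff continuously differentiable.\<close>

definition log_cutoff :: "nat \<Rightarrow> 'a::euclidean_space \<Rightarrow> real" where
  "log_cutoff n x = (log_profile n x)\<^sup>2"

text \<open>This is the chain rule where the profile is positive. The factor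
  \<open>log_profile n x\<close> makes it vanish elsewhere, so it is continuous across the edge of
  the support.\<close>

definition log_cutoff_grad :: "nat \<Rightarrow> 'a::euclidean_space \<Rightarrow> 'a" where
  "log_cutoff_grad n x = (- 4 * log_profile n x / (n * (1 + x \<bullet> x))) *\<^sub>R x"

lemma one_plus_inner_pos: "0 < 1 + (x::'a::euclidean_space) \<bullet> x"
  by (simp add: add_pos_nonneg)

lemma continuous_on_log_profile:
  "continuous_on UNIV (log_profile n :: 'a::euclidean_space \<Rightarrow> real)"
  unfolding log_profile_def divide_inverse
  by (intro continuous_intros ballI less_imp_neq[symmetric] one_plus_inner_pos)

lemma continuous_on_log_cutoff_grad:
  assumes "n > 0"
  shows "continuous_on UNIV (log_cutoff_grad n :: 'a::euclidean_space \<Rightarrow> 'a)"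
  unfolding log_cutoff_grad_def using assms one_plus_inner_pos less_imp_neq
  by (intro continuous_intros continuous_on_log_profile) fastforce

lemma log_profile_le_1: "0 \<le> log_profile n x \<and> log_profile n x \<le> 1"
  by (simp add: log_profile_def)

lemma log_profile_eq_0:
  assumes "n > 0" "exp n \<le> 1 + x \<bullet> x"
  shows "log_profile n x = 0"
proof -
  have "real n \<le> ln (1 + x \<bullet> x)"
    using assms(2) one_plus_inner_pos[of x] by (simp add: ln_ge_iff)
  then show ?thesis
    using assms(1) by (simp add: log_profile_def)
qed

text \<open>A crude radius, larger than about exp(n/2), suffices to show that the support is
  bounded. As \<open>exp n\<close> is at least 1, the norm here is at most its own square.\<close>

lemma log_profile_eq_0':
  assumes "n > 0" "norm x > exp n"
  shows "log_profile n x = 0"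
proof (rule log_profile_eq_0[OF assms(1)])
  have "1 \<le> norm x"
    using assms(2) one_le_exp_iff[of "real n"] by linarith
  then have "norm x \<le> norm x * norm x"
    by (simp add: mult_le_cancel_left1)
  then show "exp (real n) \<le> 1 + x \<bullet> x"
    using assms(2) by (simp add: dot_square_norm power2_eq_square)
qed

text \<open>Away from 0 the function agrees locally with a square or with 0. At 0 the difference
  quotient is at most \<open>\<bar>h\<bar>\<close> in absolute value.\<close>

lemma has_real_derivative_max_0_squared:
  "((\<lambda>y::real. (max 0 y)\<^sup>2) has_real_derivative 2 * max 0 y) (at y)"
proof -
  consider "y > 0" | "y < 0" | "y = 0" by linarith
  then show ?thesis
  proof cases
    case 1
    have "((\<lambda>y. y\<^sup>2) has_real_derivative 2 * max 0 y) (at y)"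
      using 1 by (auto intro!: derivative_eq_intros)
    then show ?thesis
      by (rule has_field_derivative_transform_within_open[where S = "{0<..}"]) (use 1 in auto)
  next
    case 2
    have "((\<lambda>y. 0) has_real_derivative 2 * max 0 y) (at y)"
      using 2 by simp
    then show ?thesis
      by (rule has_field_derivative_transform_within_open[where S = "{..<0}"]) (use 2 in auto)
  next
    case 3
    have "((\<lambda>h::real. (max 0 h)\<^sup>2 / h) \<longlongrightarrow> 0) (at 0)"
    proof (rule Lim_null_comparison)
      show "\<forall>\<^sub>F h::real in at 0. norm ((max 0 h)\<^sup>2 / h) \<le> \<bar>h\<bar>"
        by (intro always_eventually allI) (auto simp: max_def power2_eq_square)
      show "((\<lambda>h::real. \<bar>h\<bar>) \<longlongrightarrow> 0) (at 0)"
        using tendsto_rabs_zero[OF tendsto_ident_at] .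
    qed
    then show ?thesis
      using 3 by (simp add: DERIV_def)
  qed
qed

lemma has_derivative_log_cutoff:
  fixes x :: "'a::euclidean_space"
  assumes "n > 0"
  shows "(log_cutoff n has_derivative (\<lambda>h. log_cutoff_grad n x \<bullet> h)) (at x)"
proof -
  let ?q = "\<lambda>x::'a. 1 - ln (1 + x \<bullet> x) / n"
  have "(?q has_derivative (\<lambda>h. - 2 * (x \<bullet> h) / (n * (1 + x \<bullet> x)))) (at x)"
    using one_plus_inner_pos[of x] assms
    by (auto intro!: derivative_eq_intros simp: fun_eq_iff inner_commute divide_simps)
  from has_derivative_compose[OF this has_field_derivative_imp_has_derivative
      [OF has_real_derivative_max_0_squared]]
  show ?thesis
    by (simp add: log_cutoff_def[abs_def] log_profile_def log_cutoff_grad_def mult_ac)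
qed

lemma log_cutoff_in_H1:
  assumes "n > 0"
  shows "(log_cutoff n :: 'a::euclidean_space \<Rightarrow> real) \<in> sobolev_H1"
    and "has_weak_gradient (log_cutoff n :: 'a \<Rightarrow> real) (log_cutoff_grad n)"
proof -
  have z: "log_cutoff n x = 0" "log_cutoff_grad n x = 0" if "norm x > exp n" for x :: 'a
    using log_profile_eq_0'[OF assms that] by (auto simp: log_cutoff_def log_cutoff_grad_def)
  have c: "continuous_on UNIV (log_cutoff n :: 'a \<Rightarrow> real)"
    unfolding log_cutoff_def by (intro continuous_intros continuous_on_log_profile)
  show wg: "has_weak_gradient (log_cutoff n :: 'a \<Rightarrow> real) (log_cutoff_grad n)"
    using has_weak_gradient_of_C1_compact_support[OF has_derivative_log_cutoff
        continuous_on_log_cutoff_grad z(1)] assms by blast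
  then show "(log_cutoff n :: 'a \<Rightarrow> real) \<in> sobolev_H1"
    unfolding sobolev_H1_def
    using square_integrable_continuous_compact_support[OF c z(1)]
      square_integrable_continuous_compact_support[OF continuous_on_log_cutoff_grad[OF assms] z(2)]
    by blast
qed

section \<open>The Dirichlet energy in the plane\<close>

text \<open>Decomposition of the support into the shells where \<open>1 + |x|\<^sup>2\<close> lies between
  \<open>exp k\<close> and \<open>exp (k + 1)\<close>; in the plane each of them contributes at most \<open>pi * exp 1\<close>.\<close>

lemma norm_log_cutoff_grad_le:
  assumes "n > 0"
  shows "(norm (log_cutoff_grad n x))\<^sup>2 \<le>
    16 / (real n)\<^sup>2 * (\<Sum>k<n. exp (- real k) * indicator (ball 0 (exp ((real k + 1) / 2))) x)"
    (is "_ \<le> _ * ?S")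
proof (cases "exp n \<le> 1 + x \<bullet> x")
  case True
  then show ?thesis
    using log_profile_eq_0[OF assms True] by (simp add: log_cutoff_grad_def sum_nonneg)
next
  case False
  let ?s = "1 + x \<bullet> x"
  have s: "1 \<le> ?s" "0 < ?s"
    using one_plus_inner_pos by auto
  \<comment> \<open>This is the index of the shell containing \<open>x\<close>; the logarithm is
    nonnegative, so \<open>nat\<close> truncates nothing.\<close>
  define k where "k = nat \<lfloor>ln ?s\<rfloor>"
  have "0 \<le> ln ?s" using s by simp
  then have k: "real k \<le> ln ?s" "ln ?s < real k + 1"
    unfolding k_def by linarith+
  have "ln ?s < real n"
    using False s by (metis exp_less_cancel_iff exp_ln not_le)
  then have kn: "k < n"
    using k by linarith
  have "exp (real k) \<le> ?s" "?s < exp (real k + 1)"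
    using k s by (metis exp_le_cancel_iff exp_ln, metis exp_less_cancel_iff exp_ln)
  then have e: "1 / ?s \<le> exp (- real k)"
    by (simp add: exp_minus frac_le inverse_eq_divide)
  have "(norm x)\<^sup>2 < (exp ((real k + 1) / 2))\<^sup>2"
    using \<open>?s < _\<close> by (simp add: dot_square_norm add_divide_distrib flip: exp_double)
  \<comment> \<open>Whole balls stand in for the shells: all summands are nonnegative, so the term
    with index \<open>k\<close> alone already bounds the sum from below.\<close>
  then have "x \<in> ball 0 (exp ((real k + 1) / 2))"
    by (simp add: power2_less_imp_less)
  then have "exp (- real k) \<le> ?S"
    using member_le_sum[of k "{..<n}" "\<lambda>k. exp (- real k) * indicator (ball 0 (exp ((real k + 1) / 2))) x"] kn
    by simp
  with e have S: "1 / ?s \<le> ?S" by linarith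
  have "(norm (log_cutoff_grad n x))\<^sup>2 = 16 / (real n)\<^sup>2 * ((log_profile n x)\<^sup>2 * ((x \<bullet> x) / ?s\<^sup>2))"
    by (simp add: log_cutoff_grad_def power_mult_distrib power_divide dot_square_norm)
  also have "\<dots> \<le> 16 / (real n)\<^sup>2 * ?S"
  proof (rule mult_left_mono)
    \<comment> \<open>One factor of the squared denominator absorbs \<open>x \<bullet> x\<close>;
      the remaining reciprocal is bounded by the sum.\<close>
    have "(log_profile n x)\<^sup>2 * ((x \<bullet> x) / ?s\<^sup>2) \<le> 1 * (1 / ?s)"
    proof (rule mult_mono)
      show "(log_profile n x)\<^sup>2 \<le> 1"
        by (simp add: log_profile_le_1 power_le_one)
      show "(x \<bullet> x) / ?s\<^sup>2 \<le> 1 / ?s"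
        using divide_right_mono[of "(x \<bullet> x) / ?s" 1 ?s] s by (simp add: power2_eq_square)
    qed auto
    then show "(log_profile n x)\<^sup>2 * ((x \<bullet> x) / ?s\<^sup>2) \<le> ?S"
      using S by linarith
  qed simp
  finally show ?thesis .
qed

lemma integral_log_cutoff_grad_le:
  assumes "n > 0"
  shows "(\<integral>x. (norm (log_cutoff_grad n (x :: real ^ 2)))\<^sup>2 \<partial>lebesgue) \<le> 16 * pi * exp 1 / n"
proof -
  let ?B = "\<lambda>k. ball (0 :: real ^ 2) (exp ((real k + 1) / 2))"
  have int: "integrable lebesgue (\<lambda>x. exp (- real k) * indicator (?B k) x)" for k
    by (intro integrable_mult_right integrable_real_indicator) (auto intro!: emeasure_bounded_finite[simplified])
  \<comment> \<open>The disc has area pi * exp(k + 1), which cancels the weight exp(-k) up to a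
    factor independent of \<open>k\<close>; this is where dimension two enters. The \<open>n\<close>
    equal terms against 1/n^2 then leave 1/n.\<close>
  have "(\<integral>x. exp (- real k) * indicator (?B k) x \<partial>lebesgue) = pi * exp 1" for k
    by (simp add: circle_area field_simps flip: exp_add exp_double)
  then have "(\<integral>x. 16 / (real n)\<^sup>2 * (\<Sum>k<n. exp (- real k) * indicator (?B k) x) \<partial>lebesgue)
      = 16 * pi * exp 1 / n"
    using assms by (subst integral_mult_right_zero, subst Bochner_Integration.integral_sum[OF int])
      (simp add: power2_eq_square)
  moreover have "(\<integral>x. (norm (log_cutoff_grad n (x :: real ^ 2)))\<^sup>2 \<partial>lebesgue) \<le>
      (\<integral>x. 16 / (real n)\<^sup>2 * (\<Sum>k<n. exp (- real k) * indicator (?B k) x) \<partial>lebesgue)"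
    by (rule integral_mono'[OF _ norm_log_cutoff_grad_le[OF assms]],
        rule integrable_mult_right, rule Bochner_Integration.integrable_sum[OF int])
      (intro mult_nonneg_nonneg sum_nonneg; simp)
  ultimately show ?thesis by simp
qed

section \<open>Lower bound for the weighted norms\<close>

lemma w_ge_1: "1 \<le> w x"
proof -
  have "1 * 1 \<le> w x"
    unfolding w_def by (intro mult_mono) auto
  then show ?thesis by simp
qed

lemma w_le_4:
  assumes "norm x \<le> 1"
  shows "w x \<le> 4"
proof -
  have "ln (1 + norm x) \<le> 1"
    using ln_add_one_self_le_self[of "norm x"] assms by simp
  then have "w x \<le> 2 * 2"
    unfolding w_def using assms by (intro mult_mono) auto
  then show ?thesis by simp
qed

text \<open>On the unit disc the logarithm is at most 1, so \<open>n \<ge> 2\<close> keeps the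
  profile above 1/2; squaring gives 1/4.\<close>

lemma log_cutoff_ge:
  assumes "n \<ge> 2" "norm x \<le> 1"
  shows "1 / 4 \<le> log_cutoff n x"
proof -
  have "x \<bullet> x \<le> 1"
    using assms(2) by (simp add: dot_square_norm power_le_one)
  then have "ln (1 + x \<bullet> x) \<le> 1"
    using ln_add_one_self_le_self[of "x \<bullet> x"] by simp
  then have "ln (1 + x \<bullet> x) / n \<le> 1 / 2"
    using assms(1) by (intro frac_le) auto
  then have "1 / 2 \<le> log_profile n x"
    unfolding log_profile_def by linarith
  from power_mono[OF this, of 2] show ?thesis
    by (simp add: log_cutoff_def power_divide)
qed

lemma integral_log_cutoff_over_w_ge:
  assumes "n \<ge> 2"
  shows "pi / 256 \<le> (\<integral>x. (norm (log_cutoff n x / w x))\<^sup>2 \<partial>lebesgue)"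
proof -
  have n: "n > 0" using assms by simp
  have cw: "continuous_on UNIV w"
    unfolding w_def by (intro continuous_intros) (smt (verit) norm_ge_zero)+
  have cq: "continuous_on UNIV (\<lambda>x. log_cutoff n x / w x)"
    unfolding log_cutoff_def
    by (intro continuous_intros continuous_on_log_profile cw) (smt (verit) w_ge_1)
  \<comment> \<open>Integrability of the larger function is essential for the comparison below, as a
    Bochner integral defaults to 0 otherwise.\<close>
  have int: "integrable lebesgue (\<lambda>x. (norm (log_cutoff n x / w x))\<^sup>2)"
    using log_profile_eq_0'[OF n]
    by (intro integrable_lebesgue_compact_support[where R = "exp n"] continuous_on_power
        continuous_on_norm cq)
      (auto simp: log_cutoff_def)
  \<comment> \<open>On the disc the cutoff is at least 1/4 and the weight at most 4, and 256 is the
    square of 16.\<close>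
  have "1 / 256 * indicator (ball 0 1) x \<le> (norm (log_cutoff n x / w x))\<^sup>2" for x
  proof (cases "x \<in> ball 0 1")
    case True
    then have "1 / 4 / 4 \<le> log_cutoff n x / w x"
      using log_cutoff_ge[OF assms, of x] w_le_4[of x] w_ge_1[of x] by (intro frac_le) auto
    from power_mono[OF this, of 2] show ?thesis
      using True by (simp add: power_divide)
  qed simp
  then have "(\<integral>x. 1 / 256 * indicator (ball (0 :: real ^ 2) 1) x \<partial>lebesgue)
      \<le> (\<integral>x. (norm (log_cutoff n x / w x))\<^sup>2 \<partial>lebesgue)"
    by (intro integral_mono' int) auto
  then show ?thesis
    by (simp add: circle_area)
qed

text \<open>Weak gradients agree almost everywhere, so each \<open>G\<close> related to
  \<open>u\<close> has the same norm, and membership in \<open>sobolev_H1\<close> makes it finite.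
  Since \<open>w\<close> is at least 1, the left side is a genuine norm too.\<close>

theorem proposition5p1:
  shows "\<not> (\<exists>C>0. \<forall>u \<in> (sobolev_H1 :: (real ^ 2 \<Rightarrow> real) set). \<forall>G.
           has_weak_gradient u G \<longrightarrow> L2_norm (\<lambda>x. u x / w x) \<le> C * L2_norm G)"
proof
  assume "\<exists>C>0. \<forall>u \<in> (sobolev_H1 :: (real ^ 2 \<Rightarrow> real) set). \<forall>G.
           has_weak_gradient u G \<longrightarrow> L2_norm (\<lambda>x. u x / w x) \<le> C * L2_norm G"
  then obtain C where C: "C > 0" and hardy: "\<And>u G. u \<in> sobolev_H1 \<Longrightarrow>
      has_weak_gradient u G \<Longrightarrow> L2_norm (\<lambda>x. u x / w x) \<le> C * L2_norm G"
    by blast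
  have "pi / 256 \<le> C\<^sup>2 * (16 * pi * exp 1 / n)" if n: "n \<ge> 2" for n :: nat
  proof -
    have n0: "n > 0" using n by simp
    let ?L = "\<integral>x. (norm (log_cutoff n x / w x))\<^sup>2 \<partial>lebesgue"
    let ?R = "\<integral>x. (norm (log_cutoff_grad n (x :: real ^ 2)))\<^sup>2 \<partial>lebesgue"
    have "sqrt ?L \<le> C * sqrt ?R"
      using hardy[OF log_cutoff_in_H1[OF n0]] by (simp add: L2_norm_def)
    then have "(sqrt ?L)\<^sup>2 \<le> (C * sqrt ?R)\<^sup>2"
      by (intro power_mono) auto
    then have "?L \<le> C\<^sup>2 * ?R"
      by (simp add: power_mult_distrib)
    also have "\<dots> \<le> C\<^sup>2 * (16 * pi * exp 1 / n)"
      using integral_log_cutoff_grad_le[OF n0] by (intro mult_left_mono) auto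
    finally show ?thesis
      using integral_log_cutoff_over_w_ge[OF n] by linarith
  qed
  then have "\<forall>\<^sub>F n in sequentially. pi / 256 \<le> C\<^sup>2 * (16 * pi * exp 1 / real n)"
    by (auto simp: eventually_sequentially)
  \<comment> \<open>With \<open>C\<close> fixed, the upper bound tends to 0 while the lower bound
    pi/256 is independent of \<open>n\<close>.\<close>
  moreover have "(\<lambda>n. C\<^sup>2 * (16 * pi * exp 1 / real n)) \<longlonglongrightarrow> C\<^sup>2 * 0"
    by (intro tendsto_mult_left lim_const_over_n)
  ultimately have "pi / 256 \<le> C\<^sup>2 * 0"
    by (intro tendsto_lowerbound) auto
  then show False
    using pi_gt_zero by simp
qed

end
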